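(* Let $X$ be a real hyperelliptic curve of genus $g\ge 1$ with $n(X)\ge 1$ real connected components, given by the affine equation $$y^2=f(x)=x\prod_{i=1}^{2n(X)-2}(x-p_i)\prod_{j=1}^{g+1-n(X)}(x-q_j)(x-\overline{q_j}),$$ where the $p_i\in\mathbb{R}^*$ and $q_j\in\mathbb{C}\setminus\mathbb{R}$ are such that all roots $0,p_i,q_j,\overline{q_j}$ of $f$ are distinct. Suppose that $1\le k\le g$, and let $w_{\mathbb{C}}(g,k):=k(k+1)(g+1)$, the total number of inflection points of the complexified series $|\mathcal{L}(kD)|$. Then the complete real linear series $|\mathcal{L}_{\mathbb{R}}(kD)|$ on $X$ has precisely $$\frac{n(X)}{g+1}\,w_{\mathbb{C}}(g,k)=k(k+1)\,n(X)$$ real inflection points (counted with inflectionary weight).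
   Context: $X$ denotes the smooth projective complex curve compactifying the affine curve $y^2=f(x)$ by one point $\infty$, with the antiholomorphic involution $\sigma_X$ extending $(x,y)\mapsto(\overline{x},\overline{y})$. $X(\mathbb{R})$ is the fixed locus of $\sigma_X$ and $n(X)$ is its number of connected components. The hyperelliptic structure map is $\pi:X\to\mathbb{P}^1$, $(x,y)\mapsto x$, and $D=2\cdot\infty=\pi^*(\infty)$. $\mathcal{L}_{\mathbb{R}}(kD)$ is the real line bundle defined by $kD$, $\mathcal{L}(kD)$ is its complexification, and $|\mathcal{L}_{\mathbb{R}}(kD)|$ is the complete real linear series given by the space of all real sections $H^0(X_{\mathbb{R}},\mathcal{L}_{\mathbb{R}}(kD))$. For a linear series with section space $V$ of dimension $r+1$ and a point $p\in X$, let $o_0<\dots<o_r$ be the vanishing orders at $p$ of the nonzero sections in (the complexification of) $V$. The inflectionary weight is $|p|=\sum_{i=0}^r(o_i-i)$, and the inflection divisor is $\mathrm{Inf}=\sum_{p}|p|\cdot p$. The number of real inflection points is the degree $\deg_{\mathbb{R}}$ of the real part $\sum_{p\in X(\mathbb{R})}|p|\cdot p$ of the inflection divisor. *)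

theory Defs
  imports "HOL-Analysis.Analysis" "HOL-Computational_Algebra.Computational_Algebra"
    "HOL-Computational_Algebra.Field_as_Ring"
begin

section \<open>The curve, its real locus and its topology\<close>

text \<open>
  Throughout, \<open>f\<close> is a squarefree polynomial of odd degree \<open>2 * g + 1\<close>.
  The compact curve is the affine curve \<open>y^2 = f(x)\<close> together with one point at infinity;
  affine points are \<open>Some (x, y)\<close> and the point at infinity is \<open>None\<close>.
  As the affine curve is locally compact Hausdorff and its complement is a single point,
  the topology of the compact curve is the one-point compactification.
\<close>

type_synonym point = "(complex \<times> complex) option"

definition affine_curve :: "complex poly \<Rightarrow> (complex \<times> complex) set" where
  "affine_curve f = {(x, y). y ^ 2 = poly f x}"

definition curve_topology :: "complex poly \<Rightarrow> point topology" where
  "curve_topology f = Alexandroff_compactification (top_of_set (affine_curve f))"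

definition curve :: "complex poly \<Rightarrow> point set" where
  "curve f = topspace (curve_topology f)"

definition conjugation :: "point \<Rightarrow> point" where
  "conjugation = map_option (\<lambda>(x, y). (cnj x, cnj y))"

definition real_locus :: "complex poly \<Rightarrow> point set" where
  "real_locus f = {p \<in> curve f. conjugation p = p}"

definition num_real_components :: "complex poly \<Rightarrow> nat" where
  "num_real_components f =
     card (connected_components_of (subtopology (curve_topology f) (real_locus f)))"


section \<open>The function field\<close>

text \<open>
  The function field is \<open>C(x)[y] / (y^2 - f)\<close>, with the pair \<open>(a, b)\<close> standing for
  \<open>a + b y\<close>. Only its structure as a complex vector space and the valuations of its elements
  are needed, not its multiplication.
\<close>

type_synonym ratfun = "complex poly fract \<times> complex poly fract"

definition ratfun_scale :: "complex \<Rightarrow> ratfun \<Rightarrow> ratfun" where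
  "ratfun_scale c h = (to_fract [:c:] * fst h, to_fract [:c:] * snd h)"

interpretation ratfun: vector_space ratfun_scale
proof
  fix a b :: complex and h k :: ratfun
  have 1: "[:a + b:] = [:a:] + [:b:]" and 2: "[:a * b:] = [:a:] * [:b:]" by simp_all
  show "ratfun_scale a (h + k) = ratfun_scale a h + ratfun_scale a k"
    by (simp add: ratfun_scale_def distrib_left)
  show "ratfun_scale (a + b) h = ratfun_scale a h + ratfun_scale b h"
    unfolding ratfun_scale_def 1 to_fract_add by (simp add: distrib_right)
  show "ratfun_scale a (ratfun_scale b h) = ratfun_scale (a * b) h"
    unfolding ratfun_scale_def 2 to_fract_mult by (simp add: mult.assoc)
  show "ratfun_scale 1 h = h"
    by (simp add: ratfun_scale_def flip: one_pCons)
qed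

text \<open>The function field of the real curve: elements \<open>a + b y\<close> with \<open>a, b\<close> in \<open>R(x)\<close>.\<close>

definition real_fracts :: "complex poly fract set" where
  "real_fracts =
     {Fract (map_poly complex_of_real p) (map_poly complex_of_real q) | p q. q \<noteq> 0}"

definition real_ratfuns :: "ratfun set" where
  "real_ratfuns = real_fracts \<times> real_fracts"


section \<open>Valuations at the points of the curve\<close>

definition poly_at :: "complex poly \<Rightarrow> complex fls \<Rightarrow> complex fls" where
  "poly_at p S = poly (map_poly fls_const p) S"

definition fract_at :: "complex poly fract \<Rightarrow> complex fls \<Rightarrow> complex fls" where
  "fract_at a S = poly_at (fst (quot_of_fract a)) S / poly_at (snd (quot_of_fract a)) S"

definition ratfun_at :: "ratfun \<Rightarrow> complex fls \<times> complex fls \<Rightarrow> complex fls" where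
  "ratfun_at h = (\<lambda>(S, T). fract_at (fst h) S + fract_at (snd h) S * T)"

text \<open>The pair of power series \<open>(U, V)\<close> is a formal arc through \<open>(a, b)\<close> with non-zero velocity.\<close>

definition immersed_at :: "complex fls \<Rightarrow> complex fls \<Rightarrow> complex \<Rightarrow> complex \<Rightarrow> bool" where
  "immersed_at U V a b \<longleftrightarrow>
     (\<forall>n<0. fls_nth U n = 0 \<and> fls_nth V n = 0) \<and>
     fls_nth U 0 = a \<and> fls_nth V 0 = b \<and> (fls_nth U 1 \<noteq> 0 \<or> fls_nth V 1 \<noteq> 0)"

text \<open>
  Formal local parametrizations \<open>t \<mapsto> (x, y) = (S t, T t)\<close> at a point. With \<open>deg f = 2 g + 1\<close>,
  the smooth chart at infinity has the coordinates \<open>u = 1 / x\<close> and \<open>v = y / x ^ (g + 1)\<close>,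
  in which the curve is \<open>v^2 = u ^ (2 g + 2) * f (1 / u)\<close>, and the point at infinity is
  \<open>(u, v) = (0, 0)\<close>.
\<close>

fun local_param :: "complex poly \<Rightarrow> point \<Rightarrow> complex fls \<times> complex fls \<Rightarrow> bool" where
  "local_param f (Some (a, b)) (S, T) \<longleftrightarrow> T ^ 2 = poly_at f S \<and> immersed_at S T a b"
| "local_param f None (S, T) \<longleftrightarrow> T ^ 2 = poly_at f S \<and>
     immersed_at (inverse S) (T / S ^ ((degree f + 1) div 2)) 0 0"

text \<open>
  Two parametrizations at the same point differ by a substitution \<open>t \<mapsto> c t + \<dots>\<close> with
  \<open>c \<noteq> 0\<close>, so the orders below do not depend on the choice.
\<close>

definition chosen_param :: "complex poly \<Rightarrow> point \<Rightarrow> complex fls \<times> complex fls" where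
  "chosen_param f p = (SOME ST. local_param f p ST)"

definition ord_at :: "complex poly \<Rightarrow> point \<Rightarrow> ratfun \<Rightarrow> int" where
  "ord_at f p h = fls_subdegree (ratfun_at h (chosen_param f p))"

definition ord_dx :: "complex poly \<Rightarrow> point \<Rightarrow> int" where
  "ord_dx f p = fls_subdegree (fls_deriv (fst (chosen_param f p)))"

text \<open>The genus is the dimension of the space of regular differentials \<open>h dx\<close>.\<close>

definition genus :: "complex poly \<Rightarrow> nat" where
  "genus f = ratfun.dim {h. h = 0 \<or> (\<forall>p\<in>curve f. ord_at f p h + ord_dx f p \<ge> 0)}"


section \<open>Line bundles of divisors and inflection\<close>

type_synonym divisor = "point \<Rightarrow> int"

text \<open>
  Global sections of the line bundle of a divisor \<open>E\<close>, as rational functions \<open>h\<close> with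
  \<open>div h + E \<ge> 0\<close>; the vanishing order at \<open>p\<close> of \<open>h\<close> as a section is \<open>ord_p h + E p\<close>.
\<close>

definition sections :: "complex poly \<Rightarrow> divisor \<Rightarrow> ratfun set" where
  "sections f E = {h. h = 0 \<or> (\<forall>p\<in>curve f. ord_at f p h + E p \<ge> 0)}"

definition real_sections :: "complex poly \<Rightarrow> divisor \<Rightarrow> ratfun set" where
  "real_sections f E = sections f E \<inter> real_ratfuns"

definition complexification :: "ratfun set \<Rightarrow> ratfun set" where
  "complexification V = ratfun.span V"

definition vanishing_orders :: "complex poly \<Rightarrow> divisor \<Rightarrow> ratfun set \<Rightarrow> point \<Rightarrow> int set" where
  "vanishing_orders f E W p = {ord_at f p h + E p | h. h \<in> W \<and> h \<noteq> 0}"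

text \<open>The sum runs over \<open>i = 0, \<dots>, r\<close>, where \<open>r + 1\<close> is the dimension of \<open>W\<close>.\<close>

definition inflection_weight :: "complex poly \<Rightarrow> divisor \<Rightarrow> ratfun set \<Rightarrow> point \<Rightarrow> int" where
  "inflection_weight f E W p =
     (\<Sum>i<ratfun.dim W. sorted_list_of_set (vanishing_orders f E W p) ! i - int i)"

definition inflection_divisor :: "complex poly \<Rightarrow> divisor \<Rightarrow> ratfun set \<Rightarrow> divisor" where
  "inflection_divisor f E W = (\<lambda>p. if p \<in> curve f then inflection_weight f E W p else 0)"

text \<open>The degree of the part supported in \<open>A\<close> of a divisor.\<close>

definition degree_on :: "point set \<Rightarrow> divisor \<Rightarrow> int" where
  "degree_on A E = (\<Sum>p | p \<in> A \<and> E p \<noteq> 0. E p)"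

definition num_inflection :: "complex poly \<Rightarrow> divisor \<Rightarrow> int" where
  "num_inflection f E =
     degree_on (curve f) (inflection_divisor f E (sections f E))"

definition num_real_inflection :: "complex poly \<Rightarrow> divisor \<Rightarrow> int" where
  "num_real_inflection f E =
     degree_on (real_locus f) (inflection_divisor f E (complexification (real_sections f E)))"

text \<open>\<open>D = 2 \<infinity>\<close>, the fibre over infinity of the map \<open>(x, y) \<mapsto> x\<close>.\<close>

definition hyperelliptic_divisor :: divisor where
  "hyperelliptic_divisor = (\<lambda>p. if p = None then 2 else 0)"

definition w_complex :: "nat \<Rightarrow> nat \<Rightarrow> nat" where
  "w_complex g k = k * (k + 1) * (g + 1)"

end

theory Submission
  imports Defs
begin

text \<open>
  Why the theorem holds. Because \<open>y\<close> has a pole of order \<open>2 g + 1\<close> at infinity and \<open>k \<le> g\<close>, a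
  section of the bundle of \<open>k D\<close> cannot involve \<open>y\<close>: the sections are exactly the polynomials of
  degree at most \<open>k\<close> in \<open>x\<close> (\<open>sections_eq_poly_sections\<close>). So the series is pulled back from
  the complete series of degree \<open>k\<close> on the projective line, where the vanishing orders at every
  point are \<open>0, 1, \<dots>, k\<close>. On the curve they become \<open>0, e, \<dots>, e k\<close>, where \<open>e\<close> is the ramification
  index of the double cover \<open>(x, y) \<mapsto> x\<close> (\<open>vanishing_orders_poly_sections\<close>). The inflectionary
  weight is therefore \<open>(e - 1) k (k + 1) / 2\<close>: it vanishes where the cover is unramified and
  equals \<open>k (k + 1) / 2\<close> at each ramification point.

  It remains to count. The ramification points are the \<open>2 g + 1\<close> roots of \<open>f\<close> and infinity, which gives
  \<open>(2 g + 2) k (k + 1) / 2 = k (k + 1) (g + 1)\<close> complex inflection points. The real ones among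
  them are \<open>0\<close>, the \<open>2 n - 2\<close> numbers \<open>p\<^sub>i\<close> and infinity, which gives \<open>2 n k (k + 1) / 2\<close>. The
  monomials \<open>x\<^sup>i\<close> are real, so complexifying the real series gives back the complex one.

  Orders are measured along one arbitrarily chosen formal arc through each point. Such an arc has
  to be shown to exist (\<open>chosen_param_is_local_param\<close>); after that, only facts that hold along
  every arc are used: that \<open>x - a\<close> has order \<open>e\<close> at a point above \<open>a\<close>, and that \<open>x\<close> and \<open>y\<close>
  have orders \<open>- 2\<close> and \<open>- (2 g + 1)\<close> at infinity.
\<close>

section \<open>Substituting a series into a polynomial\<close>

lemma poly_at_0 [simp]: "poly_at 0 S = 0"
  by (simp add: poly_at_def)

lemma poly_at_pCons [simp]: "poly_at (pCons c p) S = fls_const c + S * poly_at p S"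
  by (cases "c = 0 \<and> p = 0") (auto simp: poly_at_def map_poly_pCons)

lemma poly_at_1 [simp]: "poly_at 1 S = 1"
  by (simp add: one_pCons)

lemma poly_at_add: "poly_at (p + q) S = poly_at p S + poly_at q S"
  by (induction p q rule: poly_induct2) (simp_all add: algebra_simps fls_plus_const)

lemma poly_at_smult: "poly_at (smult c p) S = fls_const c * poly_at p S"
  by (induction p) (simp_all add: algebra_simps fls_const_mult_const)

lemma poly_at_mult: "poly_at (p * q) S = poly_at p S * poly_at q S"
  by (induction p) (simp_all add: poly_at_add poly_at_smult algebra_simps)

lemma poly_at_power: "poly_at (p ^ n) S = poly_at p S ^ n"
  by (induction n) (simp_all add: poly_at_mult)

definition poly_fps :: "complex poly \<Rightarrow> complex fps \<Rightarrow> complex fps" where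
  "poly_fps p s = poly (map_poly fps_const p) s"

lemma poly_fps_0 [simp]: "poly_fps 0 s = 0"
  by (simp add: poly_fps_def)

lemma poly_fps_pCons [simp]: "poly_fps (pCons c p) s = fps_const c + s * poly_fps p s"
  by (cases "c = 0 \<and> p = 0") (auto simp: poly_fps_def map_poly_pCons)

lemma poly_at_fps_to_fls: "poly_at p (fps_to_fls s) = fps_to_fls (poly_fps p s)"
  by (induction p) (simp_all add: fls_times_fps_to_fls fps_const_to_fls)

lemma poly_fps_mult: "poly_fps (p * q) s = poly_fps p s * poly_fps q s"
proof -
  have "fps_to_fls (poly_fps (p * q) s) = fps_to_fls (poly_fps p s * poly_fps q s)"
    by (simp only: fls_times_fps_to_fls poly_at_mult flip: poly_at_fps_to_fls)
  then show ?thesis by simp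
qed

lemma poly_fps_nth_0: "fps_nth (poly_fps p s) 0 = poly p (fps_nth s 0)"
  by (induction p) (simp_all add: fps_mult_nth_0)

lemma poly_fps_nth_1:
  "fps_nth (poly_fps p s) 1 = poly (pderiv p) (fps_nth s 0) * fps_nth s 1"
  by (induction p) (simp_all add: pderiv_pCons fps_mult_nth_1 poly_fps_nth_0 algebra_simps
      del: One_nat_def)

text \<open>
  Composition of formal power series requires a zero constant term, so a substitution centred at
  \<open>a\<close> is the composition of the Taylor expansion at \<open>a\<close> with the remaining series.
\<close>
lemma poly_fps_translate:
  assumes "fps_nth s 0 = 0"
  shows "poly_fps p (fps_const a + s) = fps_compose (fps_of_poly (pcompose p [:a, 1:])) s"
  by (induction p)
    (simp_all add: pcompose_pCons fps_of_poly_simps fps_compose_add_distrib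
      fps_compose_mult_distrib assms fps_of_poly_linear algebra_simps fps_of_poly_const)

section \<open>Formal arcs on the curve\<close>

text \<open>
  Formal implicit function theorem. Above a simple root of \<open>f\<close> the coordinate \<open>y\<close> is a
  parameter, and inverting the Taylor series of \<open>f\<close> under composition solves for \<open>x\<close>.
  Elsewhere \<open>x - a\<close> is a parameter and \<open>y\<close> is the square root of \<open>f\<close> with constant term \<open>b\<close>.
\<close>
lemma smooth_arc_exists:
  assumes "poly f a = b ^ 2" and "b = 0 \<Longrightarrow> poly (pderiv f) a \<noteq> 0"
  shows "\<exists>s t. t ^ 2 = poly_fps f s \<and> fps_nth s 0 = a \<and> fps_nth t 0 = b \<and>
               (fps_nth s 1 \<noteq> 0 \<or> fps_nth t 1 \<noteq> 0)"
proof -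
  define G where "G = fps_of_poly (pcompose f [:a, 1:])"
  have G0: "fps_nth G 0 = b ^ 2"
    using assms(1) by (simp add: G_def poly_pcompose flip: poly_0_coeff_0)
  show ?thesis
  proof (cases "b = 0")
    case True
    have "fps_nth G 1 = fps_nth (poly_fps f (fps_const a + fps_X)) 1"
      by (subst poly_fps_translate) (simp_all add: G_def)
    also have "\<dots> \<noteq> 0"
      using assms(2) True by (subst poly_fps_nth_1) simp
    finally have G1: "fps_nth G 1 \<noteq> 0" .
    have G0: "fps_nth G 0 = 0" using G0 True by simp
    have inv0: "fps_nth (fps_inv G) 0 = 0" by (simp add: fps_inv_def)
    define s where "s = fps_compose (fps_inv G) (fps_X ^ 2)"
    have s0: "fps_nth s 0 = 0" by (simp add: s_def inv0)
    have "poly_fps f (fps_const a + s) = fps_compose G s"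
      using s0 by (simp add: poly_fps_translate G_def)
    also have "\<dots> = fps_compose (fps_compose G (fps_inv G)) (fps_X ^ 2)"
      unfolding s_def by (rule fps_compose_assoc) (simp_all add: inv0)
    also have "\<dots> = fps_X ^ 2"
      by (simp add: fps_inv_right[OF G0 G1])
    finally show ?thesis
      using s0 True by (intro exI[of _ "fps_const a + s"] exI[of _ fps_X]) auto
  next
    case False
    define t where "t = fps_radical (\<lambda>_ _. b) 2 G"
    have "t ^ 2 = G"
      using power_radical[of G "\<lambda>_ _. b" 1] G0 False by (simp add: t_def numeral_2_eq_2)
    then have "t ^ 2 = poly_fps f (fps_const a + fps_X)"
      by (simp add: poly_fps_translate G_def)
    then show ?thesis
      using G0 by (intro exI[of _ "fps_const a + fps_X"] exI[of _ t]) (auto simp: t_def)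
  qed
qed

lemma immersed_at_iff:
  "immersed_at U V a b \<longleftrightarrow>
     (\<exists>u v. U = fps_to_fls u \<and> V = fps_to_fls v \<and> fps_nth u 0 = a \<and> fps_nth v 0 = b \<and>
            (fps_nth u 1 \<noteq> 0 \<or> fps_nth v 1 \<noteq> 0))"
proof
  assume im: "immersed_at U V a b"
  then have "U = fps_to_fls (fls_regpart U)" "V = fps_to_fls (fls_regpart V)"
    by (simp_all add: immersed_at_def fls_subdegree_ge0I)
  then show "\<exists>u v. U = fps_to_fls u \<and> V = fps_to_fls v \<and> fps_nth u 0 = a \<and> fps_nth v 0 = b \<and>
            (fps_nth u 1 \<noteq> 0 \<or> fps_nth v 1 \<noteq> 0)"
    using im by (intro exI[of _ "fls_regpart U"] exI[of _ "fls_regpart V"])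
      (auto simp: immersed_at_def)
qed (auto simp: immersed_at_def)

lemma local_param_Some_iff:
  "local_param f (Some (a, b)) (S, T) \<longleftrightarrow>
     (\<exists>s t. S = fps_to_fls s \<and> T = fps_to_fls t \<and> t ^ 2 = poly_fps f s \<and>
        fps_nth s 0 = a \<and> fps_nth t 0 = b \<and> (fps_nth s 1 \<noteq> 0 \<or> fps_nth t 1 \<noteq> 0))"
  by (auto simp: immersed_at_iff poly_at_fps_to_fls simp flip: fps_to_fls_power)

lemma poly_at_reflect_poly:
  assumes "U \<noteq> 0"
  shows "poly_at (reflect_poly f) U = U ^ degree f * poly_at f (inverse U)"
proof -
  have *: "poly_at (p + monom c n) U = poly_at p U + fls_const c * U ^ n" for p c n
    by (simp add: poly_at_add monom_altdef poly_at_smult poly_at_power)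
  show ?thesis
    using assms by (induction f)
      (simp_all add: field_simps reflect_poly_pCons' *)
qed

text \<open>
  In the coordinates \<open>u = 1 / x\<close> and \<open>v = y / x ^ (g + 1)\<close> the curve is again of the form
  \<open>v^2 = w u\<close>, where \<open>w\<close> is \<open>u\<close> times the reversed polynomial of \<open>f\<close> and has a simple root at
  \<open>0\<close>. The affine existence result thus also serves the point at infinity.
\<close>
lemma local_param_infinity_exists:
  assumes "degree f = 2 * g + 1"
  shows "\<exists>ST. local_param f None ST"
proof -
  have f0: "f \<noteq> 0" using assms by auto
  obtain u v where uv: "v ^ 2 = poly_fps (pCons 0 (reflect_poly f)) u"
      "fps_nth u 0 = 0" "fps_nth v 0 = 0" "fps_nth u 1 \<noteq> 0 \<or> fps_nth v 1 \<noteq> 0"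
    using smooth_arc_exists[of "pCons 0 (reflect_poly f)" 0 0] f0 by (auto simp: pderiv_pCons)
  define U where "U = fps_to_fls u"
  define V where "V = fps_to_fls v"
  have eq: "V ^ 2 = U * poly_at (reflect_poly f) U"
    using uv(1) by (simp add: U_def V_def poly_at_fps_to_fls fls_times_fps_to_fls
        flip: fps_to_fls_power)
  have U0: "U \<noteq> 0"
    using uv eq by (auto simp: U_def V_def)
  have "(V / U ^ (g + 1)) ^ 2 = poly_at f (inverse U)"
    using U0 by (simp add: power_divide eq poly_at_reflect_poly assms divide_simps
        flip: power_mult power_Suc) (simp add: power2_eq_square mult_ac flip: power_add power_mult_distrib)
  then have "local_param f None (inverse U, V / U ^ (g + 1))"
    using U0 uv by (auto simp: assms immersed_at_iff field_simps U_def V_def)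
  then show ?thesis ..
qed

section \<open>Orders along an arc\<close>

definition ramification_index :: "point \<Rightarrow> int" where
  "ramification_index p = (case p of None \<Rightarrow> 2 | Some (a, b) \<Rightarrow> if b = 0 then 2 else 1)"

text \<open>
  Comparing coefficients of \<open>t^0\<close> and \<open>t^1\<close> in \<open>y^2 = f x\<close> determines which coordinate moves to
  first order. Above a root \<open>a\<close> this is \<open>y\<close>; as \<open>f\<close> is \<open>x - a\<close> times a unit there, \<open>x - a\<close> has the
  order of \<open>y^2\<close>.
\<close>
lemma affine_arc_coordinates:
  assumes "local_param f (Some (a, b)) (S, T)" and "rsquarefree f"
  obtains s t where "S = fps_to_fls s" "T = fps_to_fls t" "fps_nth s 0 = a" "fps_nth t 0 = b"
    "b = 0 \<longrightarrow> fps_nth s 1 = 0 \<and> fps_nth t 1 \<noteq> 0"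
    "int (subdegree (s - fps_const a)) = (if b = 0 then 2 else 1)"
proof -
  obtain s t where st: "S = fps_to_fls s" "T = fps_to_fls t" "t ^ 2 = poly_fps f s"
    "fps_nth s 0 = a" "fps_nth t 0 = b" "fps_nth s 1 \<noteq> 0 \<or> fps_nth t 1 \<noteq> 0"
    using assms(1) unfolding local_param_Some_iff by blast
  have c0: "b ^ 2 = poly f a"
    using arg_cong[OF st(3), of "\<lambda>F. fps_nth F 0"] st
    by (simp add: poly_fps_nth_0 power2_eq_square)
  have c1: "2 * b * fps_nth t 1 = poly (pderiv f) a * fps_nth s 1"
    using arg_cong[OF st(3), of "\<lambda>F. fps_nth F 1"] st
    by (simp add: poly_fps_nth_1 power2_eq_square fps_mult_nth_1 mult.assoc del: One_nat_def)
  have smooth: "poly f a = 0 \<longrightarrow> poly (pderiv f) a \<noteq> 0"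
    using assms(2) by (auto simp: rsquarefree_roots)
  show ?thesis
  proof (cases "b = 0")
    case True
    then have d: "fps_nth s 1 = 0" "fps_nth t 1 \<noteq> 0"
      using c0 c1 smooth st(6) by auto
    have "[:- a, 1:] dvd f"
      using c0 True by (simp add: poly_eq_0_iff_dvd flip: power2_eq_square)
    then obtain h where h: "f = [:- a, 1:] * h" ..
    have ha: "poly h a \<noteq> 0"
      using smooth c0 True unfolding h pderiv_mult
      by (simp add: pderiv_pCons del: mult_pCons_left)
    have eq: "t ^ 2 = (s - fps_const a) * poly_fps h s"
      unfolding st(3) h poly_fps_mult by (simp flip: fps_const_neg)
    have "subdegree t = 1"
      using d st True by (intro subdegreeI) auto
    then have "2 = subdegree (t ^ 2)" by simp
    also have "\<dots> = subdegree (s - fps_const a) + subdegree (poly_fps h s)"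
      unfolding eq using eq d by (intro subdegree_mult) auto
    also have "subdegree (poly_fps h s) = 0"
      using ha st by (simp add: poly_fps_nth_0)
    finally show ?thesis using that st d True by simp
  next
    case False
    then have "fps_nth s 1 \<noteq> 0"
      using c1 st(6) by auto
    then have "subdegree (s - fps_const a) = 1"
      using st by (intro subdegreeI) auto
    then show ?thesis using that st False by simp
  qed
qed

lemma poly_at_order_affine:
  assumes s: "fps_nth s 0 = a" "s \<noteq> fps_const a" and "p \<noteq> 0"
  shows "poly_at p (fps_to_fls s) \<noteq> 0"
    and "fls_subdegree (poly_at p (fps_to_fls s)) = int (order a p) * int (subdegree (s - fps_const a))"
proof -
  obtain q where q: "p = [:- a, 1:] ^ order a p * q" "\<not> [:- a, 1:] dvd q"
    using order_decomp[OF \<open>p \<noteq> 0\<close>] by blast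
  have q0: "fps_nth (poly_fps q s) 0 \<noteq> 0"
    using q(2) by (simp add: poly_fps_nth_0 s poly_eq_0_iff_dvd)
  then have qn: "poly_fps q s \<noteq> 0" by auto
  have "poly_at p (fps_to_fls s) =
      fps_to_fls (s - fps_const a) ^ order a p * fps_to_fls (poly_fps q s)"
    by (subst q(1)) (simp add: poly_at_mult poly_at_power fps_const_to_fls poly_at_fps_to_fls[of q]
        fls_const_uminus)
  then show "poly_at p (fps_to_fls s) \<noteq> 0"
    and "fls_subdegree (poly_at p (fps_to_fls s)) = int (order a p) * int (subdegree (s - fps_const a))"
    using s(2) qn q0
    by (simp_all add: fls_subdegree_pow fls_subdegree_fls_to_fps del: fps_to_fls_minus)
qed

text \<open>When \<open>x\<close> has a pole, the leading monomial of a polynomial dominates all others.\<close>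
lemma poly_at_order_infinity:
  assumes "fls_subdegree S < 0" and "p \<noteq> 0"
  shows "poly_at p S \<noteq> 0 \<and> fls_subdegree (poly_at p S) = int (degree p) * fls_subdegree S"
  using assms(2)
proof (induction p)
  case (pCons c p)
  show ?case
  proof (cases "p = 0")
    case False
    have S0: "S \<noteq> 0" using assms(1) by auto
    have IH: "poly_at p S \<noteq> 0" "fls_subdegree (poly_at p S) = int (degree p) * fls_subdegree S"
      using pCons.IH False by auto
    have sub: "fls_subdegree (S * poly_at p S) = int (degree p + 1) * fls_subdegree S"
      using IH S0 by (simp add: algebra_simps)
    also have "\<dots> < 0"
      using assms(1) by (simp add: mult_pos_neg)
    finally have "fls_subdegree (S * poly_at p S) < fls_subdegree (fls_const c)"
      by simp
    then have "fls_subdegree (fls_const c + S * poly_at p S) = fls_subdegree (S * poly_at p S)"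
      using S0 IH by (intro fls_subdegree_add_eq2) auto
    moreover have "fls_subdegree (S * poly_at p S) \<noteq> 0"
      using \<open>_ < fls_subdegree (fls_const c)\<close> by simp
    ultimately show ?thesis
      using sub False by auto
  qed (use pCons in auto)
qed simp

text \<open>
  Let \<open>m\<close> be the order of \<open>u = 1 / x\<close>. Then \<open>y^2 = f x\<close> has order \<open>- (2 g + 1) m\<close>, so
  \<open>v = y / x ^ (g + 1)\<close> satisfies \<open>2 ord v = m\<close>. Since \<open>m\<close> is even, \<open>u\<close> does not move to first
  order; hence \<open>v\<close> does, so \<open>ord v = 1\<close> and \<open>m = 2\<close>.
\<close>
lemma infinity_arc_orders:
  assumes "local_param f None (S, T)" and deg: "degree f = 2 * g + 1"
  shows "fls_subdegree S = - 2" "T \<noteq> 0" "fls_subdegree T = - (2 * int g + 1)"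
proof -
  have f0: "f \<noteq> 0" using deg by auto
  have eq: "T ^ 2 = poly_at f S"
    and im: "immersed_at (inverse S) (T / S ^ (g + 1)) 0 0"
    using assms by simp_all
  obtain u v where uv: "inverse S = fps_to_fls u" "T / S ^ (g + 1) = fps_to_fls v"
    "fps_nth u 0 = 0" "fps_nth v 0 = 0" "fps_nth u 1 \<noteq> 0 \<or> fps_nth v 1 \<noteq> 0"
    using im unfolding immersed_at_iff by blast
  have S0: "S \<noteq> 0"
    using uv by auto
  then have u0: "u \<noteq> 0"
    using uv(1) by auto
  have m: "fls_subdegree S = - int (subdegree u)"
    using arg_cong[OF uv(1), of fls_subdegree]
    by (simp add: fls_inverse_subdegree fls_subdegree_fls_to_fps)
  have "subdegree u > 0"
    using u0 uv(3) by (metis bot_nat_0.not_eq_extremum nth_subdegree_nonzero)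
  then have neg: "fls_subdegree S < 0"
    using m by simp
  have T2: "T ^ 2 \<noteq> 0" "fls_subdegree (T ^ 2) = (2 * int g + 1) * fls_subdegree S"
    unfolding eq using poly_at_order_infinity[OF neg f0] deg by auto
  then show T0: "T \<noteq> 0" by auto
  have T: "2 * fls_subdegree T = - (2 * int g + 1) * int (subdegree u)"
    using T2(2) m by (simp add: fls_subdegree_pow algebra_simps)
  have v0: "v \<noteq> 0"
    using uv(2) T0 S0 by auto
  have "fls_subdegree (T / S ^ (g + 1)) = fls_subdegree T - (int g + 1) * fls_subdegree S"
    using T0 S0 by (simp add: fls_divide_subdegree fls_subdegree_pow del: power_Suc)
  then have v: "int (subdegree v) = fls_subdegree T + (int g + 1) * int (subdegree u)"
    unfolding uv(2) by (simp add: fls_subdegree_fls_to_fps m)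
  have sub: "subdegree u = 2 * subdegree v"
    using T v by (simp add: algebra_simps)
  have "fps_nth u 1 = 0"
  proof (rule ccontr)
    assume "fps_nth u 1 \<noteq> 0"
    then have "subdegree u = 1" using uv by (intro subdegreeI) auto
    then show False using sub by simp
  qed
  then have "subdegree v = 1"
    using uv by (intro subdegreeI) auto
  then show "fls_subdegree S = - 2" "fls_subdegree T = - (2 * int g + 1)"
    using sub m T by simp_all
qed

lemma curve_eq: "curve f = insert None (Some ` {(x, y). y ^ 2 = poly f x})"
  by (simp add: curve_def curve_topology_def affine_curve_def)

lemma chosen_param_is_local_param:
  assumes "degree f = 2 * g + 1" and "rsquarefree f"
    and "p \<in> curve f"
  shows "local_param f p (chosen_param f p)"
proof -
  have "\<exists>ST. local_param f p ST"
  proof (cases p)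
    case None
    then show ?thesis using local_param_infinity_exists[OF assms(1)] by simp
  next
    case (Some ab)
    obtain a b where p: "p = Some (a, b)" using Some by (cases ab) auto
    with assms(3) have "poly f a = b ^ 2" by (auto simp: curve_eq)
    then obtain s t where "t ^ 2 = poly_fps f s" "fps_nth s 0 = a" "fps_nth t 0 = b"
        "fps_nth s 1 \<noteq> 0 \<or> fps_nth t 1 \<noteq> 0"
      using smooth_arc_exists[of f a b] assms(2) by (auto simp: rsquarefree_roots)
    then have "local_param f (Some (a, b)) (fps_to_fls s, fps_to_fls t)"
      unfolding local_param_Some_iff by blast
    then show ?thesis using p by blast
  qed
  then show ?thesis unfolding chosen_param_def by (rule someI_ex)
qed

lemma fract_at_to_fract [simp]: "fract_at (to_fract p) S = poly_at p S"
  by (simp add: fract_at_def)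

section \<open>The sections of the multiples of D\<close>

text \<open>
  Fractions are evaluated through their reduced representative. Any other representative gives
  the same value provided that \<open>S\<close> is not a root of a non-zero polynomial.
\<close>
lemma fract_at_divide:
  assumes "\<And>q. q \<noteq> 0 \<Longrightarrow> poly_at q S \<noteq> 0" and "d \<noteq> 0"
  shows "fract_at (to_fract p / to_fract d) S = poly_at p S / poly_at d S"
proof -
  define p' d' where "p' = fst (quot_of_fract (to_fract p / to_fract d))"
    and "d' = snd (quot_of_fract (to_fract p / to_fract d))"
  have d': "d' \<noteq> 0" by (simp add: d'_def)
  have "to_fract p' / to_fract d' = to_fract p / to_fract d"
    by (simp add: p'_def d'_def flip: Fract_conv_to_fract)
  then have "to_fract (p' * d) = to_fract (p * d')"
    using assms(2) d' by (simp add: frac_eq_eq)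
  then have "p' * d = p * d'" by (simp only: to_fract_eq_iff)
  then have "poly_at p' S * poly_at d S = poly_at p S * poly_at d' S"
    by (simp only: flip: poly_at_mult)
  then show ?thesis
    using assms d' unfolding fract_at_def p'_def[symmetric] d'_def[symmetric]
    by (simp add: frac_eq_eq)
qed

text \<open>
  The affine coordinate ring \<open>C[x, y]\<close> is integrally closed. If the common denominator \<open>d\<close> of
  \<open>(p + q y) / d\<close> has a root \<open>c\<close>, then \<open>p c + b * q c = 0\<close> for both square roots \<open>b\<close> of \<open>f c\<close>.
  These two equations force \<open>p c = q c = 0\<close> when \<open>b \<noteq> 0\<close>. When \<open>b = 0\<close> they only give
  \<open>p c = 0\<close>, and the coefficient of \<open>t^1\<close> supplies \<open>q c = 0\<close>. In both cases the factor
  \<open>x - c\<close> cancels, and the degree of \<open>d\<close> drops.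
\<close>
lemma sections_have_no_affine_poles:
  assumes deg: "degree f = 2 * g + 1"
    and smooth: "rsquarefree f"
    and regular: "\<And>a b. poly f a = b ^ 2 \<Longrightarrow>
           ord_at f (Some (a, b)) (to_fract p / to_fract d, to_fract q / to_fract d) \<ge> 0"
    and "d \<noteq> 0"
  shows "\<exists>p' q'. to_fract p / to_fract d = to_fract p' \<and> to_fract q / to_fract d = to_fract q'"
  using regular \<open>d \<noteq> 0\<close>
proof (induction "degree d" arbitrary: p q d)
  case 0
  then obtain c where c: "d = [:c:]" "c \<noteq> 0"
    using 0 degree_eq_zeroE[of d] by (metis pCons_0_0)
  have "to_fract r / to_fract d = to_fract (smult (inverse c) r)" for r
  proof -
    have "r = smult (inverse c) r * d" using c by simp
    then have "to_fract r = to_fract (smult (inverse c) r) * to_fract d"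
      by (metis to_fract_mult)
    then show ?thesis using 0 by (simp add: field_simps)
  qed
  then show ?case by blast
next
  case (Suc n)
  obtain c where c: "poly d c = 0"
    using fundamental_theorem_of_algebra_alt[of d] Suc(2)
    by (metis degree_pCons_eq_if nat.simps(3))
  have at: "poly p c + b * poly q c = 0 \<and> (b = 0 \<longrightarrow> poly q c = 0)" if b: "poly f c = b ^ 2" for b
  proof -
    define S T where "S = fst (chosen_param f (Some (c, b)))"
      and "T = snd (chosen_param f (Some (c, b)))"
    have "local_param f (Some (c, b)) (S, T)"
      using chosen_param_is_local_param[OF deg smooth, of "Some (c, b)"] b
      by (simp add: S_def T_def curve_eq)
    then obtain s t where st: "S = fps_to_fls s" "T = fps_to_fls t" "fps_nth s 0 = c"
      "fps_nth t 0 = b" "b = 0 \<longrightarrow> fps_nth s 1 = 0 \<and> fps_nth t 1 \<noteq> 0"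
      "int (subdegree (s - fps_const c)) = (if b = 0 then 2 else 1)"
      using affine_arc_coordinates smooth by blast
    have "s \<noteq> fps_const c" using st(6) by (auto split: if_splits)
    then have nz: "poly_at r S \<noteq> 0" if "r \<noteq> 0" for r
      using poly_at_order_affine(1)[OF st(3)] that st(1) by simp
    define H where "H = fls_regpart (ratfun_at (to_fract p / to_fract d, to_fract q / to_fract d) (S, T))"
    have "ratfun_at (to_fract p / to_fract d, to_fract q / to_fract d) (S, T) = fps_to_fls H"
      using Suc.prems(1)[OF b] by (simp add: ord_at_def H_def S_def T_def)
    then have "fps_to_fls H = (poly_at p S + poly_at q S * T) / poly_at d S"
      using nz Suc.prems(2)
      by (simp add: ratfun_at_def fract_at_divide add_divide_distrib)
    then have "fps_to_fls H * poly_at d S = poly_at p S + poly_at q S * T"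
      using nz Suc.prems(2) by simp
    then have "fps_to_fls (H * poly_fps d s) = fps_to_fls (poly_fps p s + poly_fps q s * t)"
      by (simp add: st poly_at_fps_to_fls fls_times_fps_to_fls)
    then have eq: "H * poly_fps d s = poly_fps p s + poly_fps q s * t"
      by (simp only: fps_to_fls_eq_iff)
    have 0: "poly p c + poly q c * b = 0"
      using arg_cong[OF eq, of "\<lambda>F. fps_nth F 0"] c by (simp add: poly_fps_nth_0 st)
    (* Neither H * d x nor p x has a linear term, since d c = 0 and x - c has order 2. *)
    have "poly q c = 0" if "b = 0"
      using arg_cong[OF eq, of "\<lambda>F. fps_nth F 1"] c st(5) that
      by (simp add: poly_fps_nth_0 poly_fps_nth_1 fps_mult_nth_1 st del: One_nat_def)
    then show ?thesis using 0 by (simp add: mult.commute)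
  qed
  define b where "b = csqrt (poly f c)"
  have b: "poly f c = b ^ 2" "poly f c = (- b) ^ 2" by (simp_all add: b_def)
  have "poly p c = 0 \<and> poly q c = 0"
    using at[OF b(1)] at[OF b(2)] by (cases "b = 0") (auto simp: algebra_simps)
  then obtain p1 q1 d1 where pqd: "p = [:- c, 1:] * p1" "q = [:- c, 1:] * q1" "d = [:- c, 1:] * d1"
    using c by (auto simp: poly_eq_0_iff_dvd dvd_def)
  have d1: "d1 \<noteq> 0" using pqd Suc.prems by auto
  have "degree d = Suc (degree d1)"
    using d1 unfolding pqd(3) by (subst degree_mult_eq) auto
  then have "n = degree d1" using Suc(2) by simp
  moreover have "to_fract p / to_fract d = to_fract p1 / to_fract d1"
    "to_fract q / to_fract d = to_fract q1 / to_fract d1"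
    unfolding pqd to_fract_mult by simp_all
  ultimately show ?case
    using Suc(1)[of d1 p1 q1] Suc.prems d1 by simp
qed

lemma ord_at_affine_poly:
  assumes "degree f = 2 * g + 1" and smooth: "rsquarefree f"
    and "poly f a = b ^ 2" and "p \<noteq> 0"
  shows "ord_at f (Some (a, b)) (to_fract p, 0) = ramification_index (Some (a, b)) * int (order a p)"
proof -
  define S T where "S = fst (chosen_param f (Some (a, b)))"
    and "T = snd (chosen_param f (Some (a, b)))"
  have "local_param f (Some (a, b)) (S, T)"
    using chosen_param_is_local_param[OF assms(1,2), of "Some (a, b)"] assms(3)
    by (simp add: S_def T_def curve_eq)
  then obtain s t where st: "S = fps_to_fls s" "T = fps_to_fls t" "fps_nth s 0 = a"
    "int (subdegree (s - fps_const a)) = (if b = 0 then 2 else 1)"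
    using affine_arc_coordinates smooth by metis
  have ne: "s \<noteq> fps_const a" using st(4) by (auto split: if_splits)
  have "ord_at f (Some (a, b)) (to_fract p, 0) = fls_subdegree (poly_at p S)"
    by (simp add: ord_at_def ratfun_at_def S_def case_prod_unfold fract_at_def[of 0])
  then show ?thesis
    using poly_at_order_affine(2)[OF st(3) ne assms(4)] st
    by (simp add: ramification_index_def)
qed

lemma ord_at_infinity_poly:
  assumes "degree f = 2 * g + 1" and "rsquarefree f" and "p \<noteq> 0"
  shows "ord_at f None (to_fract p, 0) = - 2 * int (degree p)"
proof -
  obtain S T where ST: "chosen_param f None = (S, T)" by (cases "chosen_param f None")
  then have "local_param f None (S, T)"
    using chosen_param_is_local_param[OF assms(1,2), of None] by (simp add: curve_eq)
  then have "fls_subdegree S = - 2"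
    by (rule infinity_arc_orders(1)[OF _ assms(1)])
  then show ?thesis
    using poly_at_order_infinity[of S p] assms(3)
    by (simp add: ord_at_def ratfun_at_def ST fract_at_def[of 0])
qed

text \<open>
  At infinity \<open>p\<close> has even order and \<open>q y\<close> has odd order, so the two cannot cancel, and the
  pole of \<open>y\<close> of order \<open>2 g + 1\<close> survives.
\<close>
lemma pole_at_infinity_of_y_multiple:
  assumes "degree f = 2 * g + 1" and "rsquarefree f" and "q \<noteq> 0"
  shows "ord_at f None (to_fract p, to_fract q) < - 2 * int g"
proof -
  obtain S T where ST: "chosen_param f None = (S, T)" by (cases "chosen_param f None")
  then have "local_param f None (S, T)"
    using chosen_param_is_local_param[OF assms(1,2), of None] by (simp add: curve_eq)
  note arc = infinity_arc_orders[OF this assms(1)]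
  have q: "poly_at q S \<noteq> 0" "fls_subdegree (poly_at q S) = - 2 * int (degree q)"
    using poly_at_order_infinity[of S q] arc(1) assms(3) by auto
  define Q where "Q = poly_at q S * T"
  have Q: "Q \<noteq> 0" "fls_subdegree Q = - (2 * int (degree q) + 2 * int g + 1)"
    using q arc by (auto simp: Q_def)
  have ord: "ord_at f None (to_fract p, to_fract q) = fls_subdegree (poly_at p S + Q)"
    by (simp add: ord_at_def ratfun_at_def ST Q_def)
  show ?thesis
  proof (cases "p = 0")
    case True
    then show ?thesis using ord Q by simp
  next
    case False
    then have P: "poly_at p S \<noteq> 0" "fls_subdegree (poly_at p S) = - 2 * int (degree p)"
      using poly_at_order_infinity[of S p] arc(1) by auto
    have "fls_subdegree (poly_at p S) \<noteq> fls_subdegree Q"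
      using P Q by presburger
    then consider "fls_subdegree (poly_at p S) < fls_subdegree Q"
      | "fls_subdegree Q < fls_subdegree (poly_at p S)" by linarith
    then show ?thesis
      using fls_subdegree_add_eq1[OF P(1)] fls_subdegree_add_eq2[OF Q(1)] Q(2)
      by cases (auto simp: ord)
  qed
qed

definition poly_sections :: "nat \<Rightarrow> ratfun set" where
  "poly_sections k = {(to_fract p, 0) | p. degree p \<le> k}"

lemma sections_eq_poly_sections:
  assumes deg: "degree f = 2 * g + 1" and smooth: "rsquarefree f"
    and "k \<le> g"
  shows "sections f (\<lambda>p. int k * hyperelliptic_divisor p) = poly_sections k"
proof (intro subset_antisym subsetI)
  fix h assume "h \<in> sections f (\<lambda>p. int k * hyperelliptic_divisor p)"
  then consider "h = 0" | "h \<noteq> 0"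
      and "\<And>p. p \<in> curve f \<Longrightarrow> ord_at f p h + int k * hyperelliptic_divisor p \<ge> 0"
    unfolding sections_def by blast
  then show "h \<in> poly_sections k"
  proof cases
    case 1
    then show ?thesis by (auto simp: poly_sections_def zero_prod_def intro!: exI[of _ 0])
  next
    case 2
    define a b where "a = quot_of_fract (fst h)" and "b = quot_of_fract (snd h)"
    have nz: "snd a \<noteq> 0" "snd b \<noteq> 0" by (simp_all add: a_def b_def)
    have "h = (to_fract (fst a) / to_fract (snd a), to_fract (fst b) / to_fract (snd b))"
      by (simp add: a_def b_def flip: Fract_conv_to_fract)
    then have h: "h = (to_fract (fst a * snd b) / to_fract (snd a * snd b),
                       to_fract (fst b * snd a) / to_fract (snd a * snd b))"
      using nz by simp
    have "ord_at f (Some (x, y)) h \<ge> 0" if "poly f x = y ^ 2" for x y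
      using 2(2)[of "Some (x, y)"] that by (simp add: curve_eq hyperelliptic_divisor_def)
    then have "\<exists>p q. h = (to_fract p, to_fract q)"
      using sections_have_no_affine_poles[OF deg smooth, of "fst a * snd b" "snd a * snd b" "fst b * snd a"]
        nz unfolding h by simp
    then obtain p q where pq: "h = (to_fract p, to_fract q)" by blast
    have inf: "ord_at f None h \<ge> - 2 * int k"
      using 2(2)[of None] by (simp add: curve_eq hyperelliptic_divisor_def)
    have "q = 0"
      using pole_at_infinity_of_y_multiple[OF deg smooth, of q p] inf \<open>k \<le> g\<close> pq by force
    with 2(1) pq have "p \<noteq> 0" by (auto simp: zero_prod_def)
    then have "degree p \<le> k"
      using inf ord_at_infinity_poly[OF deg smooth, of p] pq \<open>q = 0\<close> by simp
    then show ?thesis using pq \<open>q = 0\<close> by (auto simp: poly_sections_def)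
  qed
next
  fix h assume "h \<in> poly_sections k"
  then obtain p where p: "h = (to_fract p, 0)" "degree p \<le> k" by (auto simp: poly_sections_def)
  show "h \<in> sections f (\<lambda>p. int k * hyperelliptic_divisor p)"
  proof (cases "p = 0")
    case False
    have "ord_at f P h + int k * hyperelliptic_divisor P \<ge> 0" if "P \<in> curve f" for P
      using that p ord_at_infinity_poly[OF deg smooth False] ord_at_affine_poly[OF deg smooth _ False]
      by (auto simp: curve_eq hyperelliptic_divisor_def ramification_index_def)
    then show ?thesis by (simp add: sections_def)
  qed (simp add: p sections_def zero_prod_def)
qed

section \<open>Inflectionary weights\<close>

text \<open>
  Being a basis, the monomials give the dimension of the series; being real functions, they show
  that its complexified real part is the whole series.
\<close>
lemma poly_sections_basis:
  defines "B \<equiv> (\<lambda>k. (\<lambda>i. (to_fract (monom (1 :: complex) i), 0 :: complex poly fract)) ` {..k})"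
  shows "ratfun.span (B k) = poly_sections k" and "ratfun.dim (poly_sections k) = k + 1"
    and "B k \<subseteq> real_ratfuns"
proof -
  have comb: "(\<Sum>i\<le>k. ratfun_scale (c i) (to_fract (monom 1 i), 0)) =
      (to_fract (\<Sum>i\<le>k. monom (c i) i), 0)" for c
  proof -
    have "to_fract [:c i:] * to_fract (monom 1 i) = to_fract (monom (c i) i)" for i
      by (simp add: smult_monom flip: to_fract_mult)
    then show ?thesis
      by (simp add: ratfun_scale_def prod_eq_iff fst_sum snd_sum)
  qed
  have inj: "inj_on (\<lambda>i. (to_fract (monom (1 :: complex) i), 0 :: complex poly fract)) {..k}"
    by (auto simp: inj_on_def monom_eq_iff')
  have sub: "ratfun.subspace (poly_sections k)"
  proof (rule ratfun.subspaceI)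
    show "0 \<in> poly_sections k"
      by (auto simp: poly_sections_def zero_prod_def intro!: exI[of _ 0])
    show "x + y \<in> poly_sections k" if "x \<in> poly_sections k" "y \<in> poly_sections k" for x y
      using that by (fastforce simp: poly_sections_def intro: degree_add_le simp flip: to_fract_add)
    show "ratfun_scale c x \<in> poly_sections k" if "x \<in> poly_sections k" for c x
      using that
      by (force simp: poly_sections_def ratfun_scale_def simp flip: to_fract_mult
          intro: order_trans[OF degree_smult_le])
  qed
  have ind: "ratfun.independent (B k)"
  proof (rule ratfun.independent_if_scalars_zero)
    fix c x assume "(\<Sum>x\<in>B k. ratfun_scale (c x) x) = 0" and x: "x \<in> B k"
    then have "(\<Sum>i\<le>k. monom (c (to_fract (monom 1 i), 0)) i) = 0"
      using comb[of "\<lambda>i. c (to_fract (monom 1 i), 0)"] inj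
      by (simp add: B_def sum.reindex zero_prod_def del: to_fract_sum)
    then have "coeff (\<Sum>i\<le>k. monom (c (to_fract (monom 1 i), 0)) i) j = 0" for j
      by simp
    then have "(if j \<le> k then c (to_fract (monom 1 j), 0) else 0) = 0" for j
      by (simp add: coeff_sum)
    then have "c (to_fract (monom 1 j), 0) = 0" if "j \<le> k" for j
      using that by metis
    then show "c x = 0" using x by (auto simp: B_def)
  qed (simp add: B_def)
  have 0: "B k \<subseteq> poly_sections k"
    by (auto simp: B_def poly_sections_def intro: degree_monom_le order_trans)
  have 1: "ratfun.span (B k) \<subseteq> poly_sections k"
    by (rule ratfun.span_minimal[OF 0 sub])
  have 2: "poly_sections k \<subseteq> ratfun.span (B k)"
  proof
    fix h assume "h \<in> poly_sections k"
    then obtain p where p: "h = (to_fract p, 0)" "degree p \<le> k" by (auto simp: poly_sections_def)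
    have "p = (\<Sum>i\<le>k. monom (coeff p i) i)"
      using p(2) by (intro poly_eqI) (auto simp: coeff_sum coeff_eq_0)
    then have "h = (\<Sum>i\<le>k. ratfun_scale (coeff p i) (to_fract (monom 1 i), 0))"
      using p(1) by (simp only: comb)
    also have "\<dots> \<in> ratfun.span (B k)"
      by (intro ratfun.span_sum ratfun.span_scale ratfun.span_base) (auto simp: B_def)
    finally show "h \<in> ratfun.span (B k)" .
  qed
  show "ratfun.span (B k) = poly_sections k" using 1 2 by blast
  have "card (B k) = k + 1" using inj by (simp add: B_def card_image)
  then show "ratfun.dim (poly_sections k) = k + 1"
    by (rule ratfun.dim_unique[OF 0 2 ind])
  show "B k \<subseteq> real_ratfuns"
  proof -
    have "to_fract (monom 1 i) \<in> real_fracts" for i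
      unfolding real_fracts_def
      by (rule CollectI, rule exI[of _ "monom 1 i"], rule exI[of _ 1])
        (simp add: to_fract_def map_poly_monom)
    moreover have "0 \<in> real_fracts"
      unfolding real_fracts_def
      by (rule CollectI, rule exI[of _ 0], rule exI[of _ 1]) (simp add: Zero_fract_def)
    ultimately show ?thesis by (auto simp: B_def real_ratfuns_def)
  qed
qed

lemma complexification_of_real_sections:
  assumes "sections f E = poly_sections k"
  shows "complexification (real_sections f E) = sections f E"
proof -
  note basis = poly_sections_basis[of k]
  let ?B = "(\<lambda>i. (to_fract (monom (1 :: complex) i), 0 :: complex poly fract)) ` {..k}"
  have "ratfun.span (real_sections f E) \<subseteq> ratfun.span (ratfun.span ?B)"
    using assms basis(1) by (intro ratfun.span_mono) (auto simp: real_sections_def)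
  then have "ratfun.span (real_sections f E) \<subseteq> ratfun.span ?B"
    by (simp only: ratfun.span_span)
  moreover have "?B \<subseteq> real_sections f E"
    using assms basis(1,3) ratfun.span_superset[of ?B] by (auto simp: real_sections_def)
  then have "ratfun.span ?B \<subseteq> ratfun.span (real_sections f E)"
    by (rule ratfun.span_mono)
  ultimately show ?thesis
    using assms basis(1) by (auto simp: complexification_def)
qed

text \<open>
  On the projective line the order of vanishing of a polynomial \<open>q\<close>, as a section of degree
  \<open>k\<close>, is the multiplicity of the root \<open>a\<close> at a finite point and \<open>k - degree q\<close> at infinity.
  Powers of \<open>x - a\<close> and of \<open>x\<close>, respectively, realize all values from \<open>0\<close> to \<open>k\<close>, and the
  double cover multiplies them by its ramification index.
\<close>
lemma vanishing_orders_poly_sections: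
  assumes deg: "degree f = 2 * g + 1" and smooth: "rsquarefree f"
    and "p \<in> curve f"
  shows "vanishing_orders f (\<lambda>p. int k * hyperelliptic_divisor p) (poly_sections k) p =
           (\<lambda>i. ramification_index p * int i) ` {..k}"
    (is "?V = ?R")
proof -
  have V: "?V = {ord_at f p (to_fract q, 0) + int k * hyperelliptic_divisor p | q. degree q \<le> k \<and> q \<noteq> 0}"
  proof -
    have "h \<in> poly_sections k \<and> h \<noteq> 0 \<longleftrightarrow>
        (\<exists>q. h = (to_fract q, 0) \<and> degree q \<le> k \<and> q \<noteq> 0)" for h
      by (auto simp: poly_sections_def zero_prod_def)
    then show ?thesis
      unfolding vanishing_orders_def by (simp only:) blast
  qed
  show ?thesis
  proof (cases p)
    case None
    have "?V = {2 * (int k - int (degree q)) | q :: complex poly. degree q \<le> k \<and> q \<noteq> 0}"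
      unfolding V unfolding None
      by (intro Collect_cong ex_cong1)
        (auto simp: hyperelliptic_divisor_def ord_at_infinity_poly[OF deg smooth] algebra_simps)
    also have "\<dots> = (\<lambda>i. 2 * int i) ` {..k}"
    proof (intro subset_antisym subsetI)
      fix m assume "m \<in> (\<lambda>i. 2 * int i) ` {..k}"
      then obtain i where "i \<le> k" "m = 2 * int i" by auto
      then show "m \<in> {2 * (int k - int (degree q)) | q :: complex poly. degree q \<le> k \<and> q \<noteq> 0}"
        by (intro CollectI exI[of _ "monom 1 (k - i)"]) (simp add: degree_monom_eq of_nat_diff)
    next
      fix m assume "m \<in> {2 * (int k - int (degree q)) | q :: complex poly. degree q \<le> k \<and> q \<noteq> 0}"
      then obtain q :: "complex poly" where "degree q \<le> k" "m = 2 * (int k - int (degree q))" by auto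
      then show "m \<in> (\<lambda>i. 2 * int i) ` {..k}"
        by (intro image_eqI[of _ _ "k - degree q"]) (auto simp: of_nat_diff)
    qed
    finally show ?thesis by (simp add: None ramification_index_def)
  next
    case (Some ab)
    obtain a b where p: "p = Some (a, b)" using Some by (cases ab) auto
    then have ab: "poly f a = b ^ 2" using assms(3) by (auto simp: curve_eq)
    have "?V = {ramification_index p * int (order a q) | q. degree q \<le> k \<and> q \<noteq> 0}"
      unfolding V unfolding p
      by (intro Collect_cong ex_cong1)
        (auto simp: hyperelliptic_divisor_def ord_at_affine_poly[OF deg smooth ab])
    also have "\<dots> = ?R"
    proof (intro subset_antisym subsetI)
      fix m assume "m \<in> ?R"
      then obtain i where "i \<le> k" "m = ramification_index p * int i" by auto
      then show "m \<in> {ramification_index p * int (order a q) | q. degree q \<le> k \<and> q \<noteq> 0}"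
        by (intro CollectI exI[of _ "[:- a, 1:] ^ i"])
          (simp add: order_power_n_n degree_linear_power)
    next
      fix m assume "m \<in> {ramification_index p * int (order a q) | q. degree q \<le> k \<and> q \<noteq> 0}"
      then obtain q where "degree q \<le> k" "q \<noteq> 0" "m = ramification_index p * int (order a q)" by auto
      then show "m \<in> ?R"
        using order_degree[of q a] by auto
    qed
    finally show ?thesis .
  qed
qed

lemma inflection_weight_of_progression:
  assumes "vanishing_orders f E W p = (\<lambda>i. e * int i) ` {..k}" and "e > 0"
    and "ratfun.dim W = k + 1"
  shows "2 * inflection_weight f E W p = (e - 1) * int (k * (k + 1))"
proof -
  have "sorted_list_of_set ((\<lambda>i. e * int i) ` {..k}) = map (\<lambda>i. e * int i) [0..<Suc k]"
  proof (rule iffD1[OF sorted_list_of_set_unique], safe)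
    show "sorted_wrt (<) (map (\<lambda>i. e * int i) [0..<Suc k])"
      using assms(2) by (simp add: sorted_wrt_map sorted_wrt_iff_nth_less nth_append del: upt_Suc)
    have "inj_on (\<lambda>i. e * int i) {..k}" using assms(2) by (auto simp: inj_on_def)
    then show "length (map (\<lambda>i. e * int i) [0..<Suc k]) = card ((\<lambda>i. e * int i) ` {..k})"
      by (simp add: card_image)
  qed (auto simp: less_Suc_eq_le simp del: upt_Suc)
  then have "inflection_weight f E W p = (\<Sum>i<Suc k. e * int i - int i)"
    unfolding inflection_weight_def assms(1,3) by (intro sum.cong) (auto simp del: upt_Suc)
  also have "\<dots> = (e - 1) * (\<Sum>i<Suc k. int i)"
    by (simp add: sum_distrib_left algebra_simps sum_subtractf)
  finally have "2 * inflection_weight f E W p = (e - 1) * (2 * (\<Sum>i<Suc k. int i))" by simp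
  also have "2 * (\<Sum>i<Suc k. int i) = int (k * (k + 1))"
    by (induction k) (auto simp: algebra_simps)
  finally show ?thesis .
qed

section \<open>Counting inflection points\<close>

definition ramification_points :: "complex poly \<Rightarrow> point set" where
  "ramification_points f = insert None ((\<lambda>a. Some (a, 0)) ` {a. poly f a = 0})"

text \<open>
  The statement is for a subset \<open>A\<close> of the curve in order to cover the whole curve and its real
  locus at once, and is doubled to avoid a division, the
  weight of a ramification point being \<open>k (k + 1) / 2\<close>.
\<close>
lemma degree_of_inflection_divisor:
  assumes deg: "degree f = 2 * g + 1" and smooth: "rsquarefree f"
    and "k \<le> g" and "A \<subseteq> curve f"
    and E_def: "E = (\<lambda>p. int k * hyperelliptic_divisor p)"
  shows "2 * degree_on A (inflection_divisor f E (sections f E)) =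
           int (card (A \<inter> ramification_points f) * (k * (k + 1)))"
proof -
  let ?I = "inflection_divisor f E (sections f E)"
  have sec: "sections f E = poly_sections k"
    unfolding E_def by (rule sections_eq_poly_sections[OF deg smooth \<open>k \<le> g\<close>])
  have I: "2 * ?I p = (if p \<in> ramification_points f then int (k * (k + 1)) else 0)" if "p \<in> curve f" for p
  proof -
    have "2 * ?I p = (ramification_index p - 1) * int (k * (k + 1))"
      unfolding inflection_divisor_def sec if_P[OF that]
    proof (rule inflection_weight_of_progression)
      show "vanishing_orders f E (poly_sections k) p = (\<lambda>i. ramification_index p * int i) ` {..k}"
        unfolding E_def by (rule vanishing_orders_poly_sections[OF deg smooth that])
      show "ramification_index p > 0"
        by (auto simp: ramification_index_def split: option.split)
    qed (rule poly_sections_basis(2))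
    also have "\<dots> = (if p \<in> ramification_points f then int (k * (k + 1)) else 0)"
      using that by (auto simp: ramification_index_def ramification_points_def curve_eq)
    finally show ?thesis .
  qed
  have "f \<noteq> 0" using deg by auto
  then have fin: "finite (ramification_points f)"
    by (simp add: ramification_points_def poly_roots_finite)
  have "degree_on A ?I = (\<Sum>p\<in>A \<inter> ramification_points f. ?I p)"
    unfolding degree_on_def
  proof (rule sum.mono_neutral_left)
    have "?I p = 0" if "p \<in> A" "p \<notin> ramification_points f" for p
      using I[of p] that assms(4) by auto
    then show "{p \<in> A. ?I p \<noteq> 0} \<subseteq> A \<inter> ramification_points f" by blast
  qed (use fin in auto)
  then have "2 * degree_on A ?I = (\<Sum>p\<in>A \<inter> ramification_points f. 2 * ?I p)"
    by (simp add: sum_distrib_left)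
  also have "\<dots> = (\<Sum>p\<in>A \<inter> ramification_points f. int (k * (k + 1)))"
    using I assms(4) by (intro sum.cong) auto
  finally show ?thesis by simp
qed

lemma prod_linear_factors:
  fixes f :: "complex poly"
  assumes "finite A" and "f = (\<Prod>a\<in>A. [:- a, 1:])"
  shows "{a. poly f a = 0} = A" and "degree f = card A"
    and "rsquarefree f"
proof -
  show roots: "{a. poly f a = 0} = A"
    using assms by (auto simp: poly_prod)
  show "degree f = card A"
    unfolding assms(2) by (subst degree_prod_eq_sum_degree) auto
  show "rsquarefree f"
    unfolding rsquarefree_roots
  proof (intro allI notI)
    fix a assume a: "poly f a = 0 \<and> poly (pderiv f) a = 0"
    then have "a \<in> A" using roots by blast
    then have "f = [:- a, 1:] * (\<Prod>b\<in>A - {a}. [:- b, 1:])"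
      unfolding assms(2) by (rule prod.remove[OF assms(1)])
    then have "poly (pderiv f) a \<noteq> 0"
      using assms(1) by (simp add: pderiv_mult pderiv_pCons poly_prod del: mult_pCons_left)
    with a show False by simp
  qed
qed

theorem theorem1:
  fixes g n k :: nat and ps :: "real list" and qs :: "complex list" and f :: "complex poly"
    and E :: divisor
  assumes f_def: "f = [:0, 1:] * (\<Prod>p\<leftarrow>ps. [:- complex_of_real p, 1:])
                             * (\<Prod>q\<leftarrow>qs. [:- q, 1:] * [:- cnj q, 1:])"
    and "length ps + 2 = 2 * n" and "length qs + n = g + 1"
    and "\<forall>p\<in>set ps. p \<noteq> 0" and "\<forall>q\<in>set qs. q \<notin> \<real>"
    and "distinct (0 # map complex_of_real ps @ qs @ map cnj qs)"
    and "g \<ge> 1" and "genus f = g"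
    and "n \<ge> 1" and "num_real_components f = n"
    and "1 \<le> k" and "k \<le> g"
    and E_def: "E = (\<lambda>p. int k * hyperelliptic_divisor p)"
  shows "num_inflection f E = int (w_complex g k) \<and>
         real_of_int (num_real_inflection f E) = real n / real (g + 1) * real (w_complex g k) \<and>
         real n / real (g + 1) * real (w_complex g k) = real (k * (k + 1) * n)"
proof -
  let ?R = "0 # map complex_of_real ps" and ?Q = "qs @ map cnj qs"
  note dist = \<open>distinct (0 # map complex_of_real ps @ qs @ map cnj qs)\<close>
  have "f = (\<Prod>a\<leftarrow>?R @ ?Q. [:- a, 1:])"
  proof -
    have "(\<Prod>q\<leftarrow>qs. [:- q, 1:] * [:- cnj q, 1:]) = (\<Prod>a\<leftarrow>?Q. [:- a, 1:])"
      by (induction qs) (simp_all add: mult_ac del: mult_pCons_left mult_pCons_right)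
    then show ?thesis
      unfolding f_def by (simp add: comp_def mult_ac del: mult_pCons_left mult_pCons_right)
  qed
  also have "\<dots> = (\<Prod>a\<in>set (?R @ ?Q). [:- a, 1:])"
    using dist by (intro prod.distinct_set_conv_list[symmetric]) simp
  finally have f_prod: "f = (\<Prod>a\<in>set (?R @ ?Q). [:- a, 1:])" .
  note lin = prod_linear_factors[OF finite_set f_prod]
  have card_roots: "card (set (?R @ ?Q)) = 2 * g + 1"
    using distinct_card[of "?R @ ?Q"] dist assms(2,3) by simp
  then have deg: "degree f = 2 * g + 1" using lin(2) by simp
  have "set ?Q \<inter> \<real> = {}"
    using assms(5) by (auto simp: Reals_cnj_iff)
  then have real_roots: "{a. poly f a = 0} \<inter> \<real> = set ?R"
    unfolding lin(1) by auto
  have card_real: "card (set ?R) = 2 * n - 1"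
    using distinct_card[of ?R] dist assms(2) by simp

  have branch: "ramification_points f \<subseteq> curve f"
    by (auto simp: ramification_points_def curve_eq)
  have card_Some: "card (insert None ((\<lambda>a. Some (a, 0 :: complex)) ` B)) = Suc (card B)"
    if "finite B" for B :: "complex set"
    using that by (subst card_insert_disjoint) (auto simp: card_image inj_on_def)
  have "card (curve f \<inter> ramification_points f) = card (ramification_points f)"
    using branch by (simp add: Int_absorb1)
  also have "\<dots> = 2 * g + 2"
    unfolding ramification_points_def lin(1) card_Some[OF finite_set] card_roots by simp
  finally have total: "num_inflection f E = int (k * (k + 1) * (g + 1))"
    using degree_of_inflection_divisor[OF deg lin(3) \<open>k \<le> g\<close> subset_refl E_def]
    by (simp add: num_inflection_def algebra_simps)

  have "real_locus f \<inter> ramification_points f = insert None ((\<lambda>a. Some (a, 0)) ` ({a. poly f a = 0} \<inter> \<real>))"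
    by (auto simp: real_locus_def conjugation_def ramification_points_def curve_eq Reals_cnj_iff)
  then have "card (real_locus f \<inter> ramification_points f) = 2 * n"
    unfolding real_roots using card_Some[OF finite_set, of ?R] card_real \<open>n \<ge> 1\<close>
    by (simp del: list.set)
  moreover have "real_locus f \<subseteq> curve f" by (auto simp: real_locus_def)
  moreover have "complexification (real_sections f E) = sections f E"
    using sections_eq_poly_sections[OF deg lin(3) \<open>k \<le> g\<close>]
    by (intro complexification_of_real_sections) (simp add: E_def)
  ultimately have "num_real_inflection f E = int (k * (k + 1) * n)"
    using degree_of_inflection_divisor[OF deg lin(3) \<open>k \<le> g\<close> _ E_def, of "real_locus f"]
    by (simp add: num_real_inflection_def algebra_simps)
  with total show ?thesis
    by (simp add: w_complex_def field_simps)
qed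

end
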